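(* For every Eulerian binary matroid $M \subseteq \mathbb{F}_2^n \setminus \{0\}$, $$c(M) \le (1 + o(1)) \frac{|M| \log(\operatorname{rank}(M))}{\log |M|} \quad \text{as } |M| \to \infty.$$ That is, for every $\varepsilon > 0$ there exists $m_0$ such that for every $n \ge 1$ and every Eulerian binary matroid $M \subseteq \mathbb{F}_2^n \setminus \{0\}$ with $|M| \ge m_0$, $c(M) \le (1+\varepsilon)\, |M| \log(\operatorname{rank}(M)) / \log|M|$.
   Context: A (simple) binary matroid is a subset $M \subseteq \mathbb{F}_2^n \setminus \{0\}$ for some $n \ge 1$. Its rank, $\operatorname{rank}(M)$, is the size of a largest subset of $M$ that is linearly independent over $\mathbb{F}_2$. $M$ is Eulerian if $\sum_{x \in M} x = 0$ in $\mathbb{F}_2^n$. A subset $N \subseteq M$ is a circuit if it is a minimal (with respect to inclusion) non-empty Eulerian subset of $M$. A circuit decomposition of $M$ is a collection of pairwise disjoint circuits of $M$ whose union is $M$; one exists if and only if $M$ is Eulerian. For Eulerian $M$, $c(M)$ denotes the minimum number of circuits in a circuit decomposition of $M$. *)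

theory Defs
  imports Complex_Main "HOL-Library.Z2" "HOL-Library.Function_Algebras"
begin

text \<open>
  Vectors over the field of two elements are functions from \<^typ>\<open>nat\<close> to \<^typ>\<open>bit\<close>.  The dimension is a
  variable and not a type, so that it can be quantified inside a formula: the space of dimension
  \<open>n\<close> consists of the functions that vanish outside \<open>{..<n}\<close>.  Addition and zero are the pointwise
  ones.
\<close>

type_synonym bitvec = "nat \<Rightarrow> bit"

definition bitvec_scale :: "bit \<Rightarrow> bitvec \<Rightarrow> bitvec" where
  "bitvec_scale c v = (\<lambda>i. c * v i)"

global_interpretation bitvec: vector_space bitvec_scale
  by unfold_locales (auto simp: bitvec_scale_def fun_eq_iff algebra_simps)

definition F2_space :: "nat \<Rightarrow> bitvec set" where
  "F2_space n = {v. \<forall>i. n \<le> i \<longrightarrow> v i = 0}"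

definition binary_matroid :: "nat \<Rightarrow> bitvec set \<Rightarrow> bool" where
  "binary_matroid n M \<longleftrightarrow> M \<subseteq> F2_space n - {0}"

definition matroid_rank :: "bitvec set \<Rightarrow> nat" where
  "matroid_rank M = Max {card S | S. S \<subseteq> M \<and> bitvec.independent S}"

definition eulerian :: "bitvec set \<Rightarrow> bool" where
  "eulerian M \<longleftrightarrow> (\<Sum>x\<in>M. x) = 0"

definition circuit :: "bitvec set \<Rightarrow> bitvec set \<Rightarrow> bool" where
  "circuit M N \<longleftrightarrow> N \<subseteq> M \<and> N \<noteq> {} \<and> eulerian N \<and>
     (\<forall>N'. N' \<subset> N \<longrightarrow> N' \<noteq> {} \<longrightarrow> \<not> eulerian N')"

definition circuit_decomposition :: "bitvec set \<Rightarrow> bitvec set set \<Rightarrow> bool" where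
  "circuit_decomposition M D \<longleftrightarrow>
     (\<forall>N\<in>D. circuit M N) \<and> pairwise disjnt D \<and> \<Union>D = M"

definition circuit_number :: "bitvec set \<Rightarrow> nat" where
  "circuit_number M = (LEAST k. \<exists>D. circuit_decomposition M D \<and> card D = k)"

lemma finite_F2_space: "finite (F2_space n)"
proof -
  have "finite {v :: bitvec. \<forall>i. (i \<in> {..<n} \<longrightarrow> v i \<in> {0, 1}) \<and> (i \<notin> {..<n} \<longrightarrow> v i = 0)}"
    by (rule finite_set_of_finite_funs) auto
  moreover have "F2_space n \<subseteq> {v. \<forall>i. (i \<in> {..<n} \<longrightarrow> v i \<in> {0, 1}) \<and> (i \<notin> {..<n} \<longrightarrow> v i = 0)}"
    by (auto simp: F2_space_def)
  ultimately show ?thesis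
    by (rule finite_subset[rotated])
qed

lemma binary_matroid_finite: "binary_matroid n M \<Longrightarrow> finite M"
  by (meson Diff_subset binary_matroid_def finite_F2_space finite_subset)

text \<open>The minimum in \<^const>\<open>circuit_number\<close> is over a non-empty set exactly for the Eulerian matroids.\<close>

lemma circuit_decomposition_exists:
  assumes "finite M" and "eulerian M"
  shows "\<exists>D. circuit_decomposition M D"
  using assms
proof (induction "card M" arbitrary: M rule: less_induct)
  case less
  show ?case
  proof (cases "M = {}")
    case True
    then show ?thesis
      by (auto simp: circuit_decomposition_def intro!: exI[of _ "{}"])
  next
    case False
    define F where "F = {N. N \<subseteq> M \<and> N \<noteq> {} \<and> eulerian N}"
    have "finite F" "F \<noteq> {}"
      using less.prems False by (auto simp: F_def)
    from finite_has_minimal[OF this]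
    obtain N where N: "N \<in> F" "\<And>N'. N' \<in> F \<Longrightarrow> N' \<subseteq> N \<Longrightarrow> N = N'"
      by metis
    have NM: "N \<subseteq> M" "N \<noteq> {}" "eulerian N"
      using N(1) by (simp_all add: F_def)
    have circ: "circuit M N"
    proof -
      have "\<not> eulerian N'" if N': "N' \<subset> N" "N' \<noteq> {}" for N'
      proof
        assume "eulerian N'"
        moreover have "N' \<subseteq> M"
          using N'(1) NM(1) by blast
        ultimately have "N' \<in> F"
          using N'(2) by (simp add: F_def)
        then show False
          using N(2) N'(1) by blast
      qed
      then show ?thesis
        using NM by (simp add: circuit_def)
    qed
    have "eulerian (M - N)"
      using NM less.prems by (simp add: eulerian_def sum_diff)
    moreover have "card (M - N) < card M"
      using NM less.prems by (intro psubset_card_mono) auto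
    ultimately obtain D where D: "circuit_decomposition (M - N) D"
      using less.hyps less.prems by blast
    have sub: "K \<subseteq> M - N" "circuit M K" if "K \<in> D" for K
      using D that unfolding circuit_decomposition_def circuit_def by blast+
    have "\<Union>(insert N D) = M"
      using D NM(1) unfolding circuit_decomposition_def by blast
    moreover have "pairwise disjnt (insert N D)"
      using D sub(1) unfolding circuit_decomposition_def pairwise_insert disjnt_def by blast
    ultimately have "circuit_decomposition M (insert N D)"
      using circ sub(2) unfolding circuit_decomposition_def by blast
    then show ?thesis ..
  qed
qed

lemma circuit_decomposition_eulerian:
  assumes "finite M" and "circuit_decomposition M D"
  shows "eulerian M"
proof -
  have "\<forall>N\<in>D. finite N" "\<forall>A\<in>D. \<forall>B\<in>D. A \<noteq> B \<longrightarrow> A \<inter> B = {}" "M = \<Union>D"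
    using assms by (auto simp: circuit_decomposition_def circuit_def pairwise_def disjnt_def
        intro: finite_subset)
  then have "(\<Sum>x\<in>M. x) = (\<Sum>N\<in>D. \<Sum>x\<in>N. x)"
    by (simp add: sum.Union_disjoint)
  also have "\<dots> = 0"
    using assms by (intro sum.neutral) (auto simp: circuit_decomposition_def circuit_def eulerian_def)
  finally show ?thesis
    by (simp add: eulerian_def)
qed

end

theory Submission
  imports Defs "HOL-Real_Asymp.Real_Asymp"
begin

text \<open>
  Circuits of more than \<open>q\<close> elements are removed one after the other for as long as there are any.
  Each removal costs one circuit and uses up at least \<open>q + 1\<close> elements, so there are at most
  \<open>\<bar>M\<bar> / (q + 1)\<close> of them.  What remains is Eulerian and has no circuit longer than \<open>q\<close>, and such a
  matroid is small: fix a basis \<open>B\<close> of it; an element outside \<open>B\<close> together with the basis elements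
  that sum to it forms a circuit (\<open>fundamental_circuit\<close>), so it is a sum of fewer than \<open>q\<close> elements of \<open>B\<close>, and there are at
  most \<open>r ^ q\<close> such sums, where \<open>r\<close> is the rank (\<open>card_le_rank_power\<close>).  Even if every remaining
  element counted as a circuit, this would give \<open>c(M) \<le> \<bar>M\<bar> / (q + 1) + r ^ q\<close>
  (\<open>circuit_number_le\<close>).

  The two terms are balanced by the choice \<open>q = \<lfloor>(1 - \<delta>) L\<rfloor>\<close> with \<open>L = ln \<bar>M\<bar> / ln r\<close>.  The first is at
  most \<open>\<bar>M\<bar> / ((1 - \<delta>) L)\<close>, which is the desired bound up to the factor \<open>1 / (1 - \<delta>)\<close>.  The second is
  at most \<open>r powr ((1 - \<delta>) L) = \<bar>M\<bar> powr (1 - \<delta>)\<close>, which is negligible because \<open>L\<close> is only logarithmic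
  in \<open>\<bar>M\<bar>\<close>.
\<close>

section \<open>Sums over the two-element field\<close>

lemma bitvec_add_self: "x + x = (0 :: bitvec)"
  by (simp add: fun_eq_iff)

lemma bitvec_add_eq_0_iff: "x + y = (0 :: bitvec) \<longleftrightarrow> x = y"
  by (metis add_left_cancel bitvec_add_self)

lemma in_span_imp_subset_sum:
  assumes "finite B" "x \<in> bitvec.span B"
  obtains S where "S \<subseteq> B" "\<Sum>S = x"
proof -
  obtain u where u: "x = (\<Sum>v\<in>B. bitvec_scale (u v) v)"
    using assms by (auto simp: bitvec.span_finite)
  have "bitvec_scale (u v) v = (if u v = 1 then v else 0)" for v
    by (cases "u v") (auto simp: bitvec_scale_def fun_eq_iff)
  then have "x = \<Sum>{v \<in> B. u v = 1}"
    using assms(1) by (simp add: u sum.inter_filter)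
  then show thesis
    by (intro that[of "{v \<in> B. u v = 1}"]) auto
qed

lemma independent_subset_sum_nonzero:
  assumes "finite B" "bitvec.independent B" "T \<subseteq> B" "T \<noteq> {}"
  shows "\<Sum>T \<noteq> 0"
proof
  assume "\<Sum>T = 0"
  then have "(\<Sum>v\<in>T. bitvec_scale 1 v) = 0"
    by simp
  moreover obtain v where "v \<in> T"
    using assms(4) by blast
  moreover have "finite T"
    using assms(1,3) finite_subset by blast
  ultimately have "(1 :: bit) = 0"
    using bitvec.independentD[OF assms(2) _ assms(3), of "\<lambda>_. 1" v] by blast
  then show False
    by simp
qed

section \<open>Fundamental circuits\<close>

text \<open>
  A smaller Eulerian subset would either lie inside \<open>B\<close> or express \<open>\<Sum>S\<close> by a second subset of \<open>B\<close>;
  independence excludes both.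
\<close>

lemma fundamental_circuit:
  assumes "finite B" "bitvec.independent B" "S \<subseteq> B" "\<Sum>S \<notin> B"
  shows "circuit (insert (\<Sum>S) B) (insert (\<Sum>S) S)"
proof -
  let ?x = "\<Sum>S"
  have fin: "finite S" and notin: "?x \<notin> S"
    using assms finite_subset by auto
  have "eulerian (insert ?x S)"
    using fin notin by (simp add: eulerian_def bitvec_add_self)
  moreover have "\<not> eulerian N" if N: "N \<subset> insert ?x S" "N \<noteq> {}" for N
  proof (cases "?x \<in> N")
    case True
    define T where "T = N - {?x}"
    have T: "T \<subset> S" "N = insert ?x T" "?x \<notin> T"
      using N True notin by (auto simp: T_def)
    show ?thesis
    proof
      assume "eulerian N"
      moreover have "finite T"
        using T(1) fin finite_subset by blast
      ultimately have "?x = \<Sum>T"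
        using T(2,3) by (simp add: eulerian_def bitvec_add_eq_0_iff)
      \<comment> \<open>Two different subsets of \<open>B\<close> with the same sum contradict independence.\<close>
      then have "\<Sum>(S - T) = 0"
        using T(1) fin by (simp add: sum_diff psubset_imp_subset)
      moreover have "\<Sum>(S - T) \<noteq> 0"
        using T(1) assms(1-3) by (intro independent_subset_sum_nonzero[of B]) auto
      ultimately show False
        by simp
    qed
  next
    case False
    with N assms(3) have "N \<subseteq> B"
      by auto
    with assms N(2) show ?thesis
      unfolding eulerian_def by (metis independent_subset_sum_nonzero)
  qed
  ultimately show ?thesis
    using assms(3) by (auto simp: circuit_def)
qed

lemma circuit_mono: "circuit N C \<Longrightarrow> N \<subseteq> M \<Longrightarrow> circuit M C"
  by (auto simp: circuit_def)

section \<open>Rank and bases\<close>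

lemma matroid_rank_ge_card:
  assumes "finite M" "S \<subseteq> M" "bitvec.independent S"
  shows "card S \<le> matroid_rank M"
proof -
  have "finite {card S | S. S \<subseteq> M \<and> bitvec.independent S}"
    using assms(1) by (intro finite_image_set) auto
  then show ?thesis
    unfolding matroid_rank_def using assms by (intro Max_ge) auto
qed

lemma matroid_rank_mono:
  assumes "finite M" "N \<subseteq> M"
  shows "matroid_rank N \<le> matroid_rank M"
  unfolding matroid_rank_def
proof (rule Max_mono)
  show "{card S |S. S \<subseteq> N \<and> bitvec.independent S} \<noteq> {}"
    using bitvec.independent_empty by blast
  show "finite {card S |S. S \<subseteq> M \<and> bitvec.independent S}"
    using assms(1) by (intro finite_image_set) auto
qed (use assms(2) in blast)

lemma basis_of_matroid:
  assumes "finite M"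
  obtains B where "B \<subseteq> M" "finite B" "bitvec.independent B" "M \<subseteq> bitvec.span B"
    "card B \<le> matroid_rank M"
  using bitvec.basis_exists[of M] matroid_rank_ge_card[OF assms] finite_subset[OF _ assms] by metis

text \<open>This keeps the rank of a large matroid above \<open>1\<close>, and hence its logarithm away from \<open>0\<close>.\<close>

lemma card_le_two_power_rank:
  assumes "finite M"
  shows "card M \<le> 2 ^ matroid_rank M"
proof -
  obtain B where B: "finite B" "M \<subseteq> bitvec.span B" "card B \<le> matroid_rank M"
    using basis_of_matroid[OF assms] by metis
  have "M \<subseteq> Sum ` Pow B"
    using B(1,2) by (auto elim!: in_span_imp_subset_sum)
  then have "card M \<le> card (Pow B)"
    using B(1) by (intro surj_card_le) auto
  also have "\<dots> \<le> 2 ^ matroid_rank M"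
    using B by (simp add: card_Pow)
  finally show ?thesis .
qed

section \<open>Matroids without long circuits\<close>

text \<open>Each such subset is the set of entries of a list of length exactly \<open>q\<close>, padded by repetition.\<close>

lemma card_small_nonempty_subsets_le:
  assumes "finite B"
  shows "card {S. S \<subseteq> B \<and> S \<noteq> {} \<and> card S \<le> q} \<le> card B ^ q"
proof -
  let ?L = "{xs. set xs \<subseteq> B \<and> length xs = q}"
  have "{S. S \<subseteq> B \<and> S \<noteq> {} \<and> card S \<le> q} \<subseteq> set ` ?L"
  proof
    fix S assume "S \<in> {S. S \<subseteq> B \<and> S \<noteq> {} \<and> card S \<le> q}"
    then have S: "S \<subseteq> B" "S \<noteq> {}" "card S \<le> q" "finite S"
      using assms finite_subset by auto
    obtain xs where xs: "set xs = S" "distinct xs"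
      using finite_distinct_list S(4) by blast
    obtain a where "a \<in> S"
      using S(2) by blast
    then have "set (xs @ replicate (q - length xs) a) = S"
      using xs by (auto simp: set_replicate_conv_if)
    moreover have "length (xs @ replicate (q - length xs) a) = q"
      using S(3) xs by (simp add: distinct_card[symmetric])
    ultimately show "S \<in> set ` ?L"
      using S(1) by (intro image_eqI[of _ _ "xs @ replicate (q - length xs) a"]) blast+
  qed
  then have "card {S. S \<subseteq> B \<and> S \<noteq> {} \<and> card S \<le> q} \<le> card ?L"
    using assms by (intro surj_card_le finite_lists_length_eq)
  then show ?thesis
    using assms by (simp add: card_lists_length_eq)
qed

text \<open>
  Over a basis \<open>B\<close> of \<open>M\<close>, every element is the sum of at most \<open>q\<close> basis elements: an element of \<open>B\<close>
  trivially, any other one because its fundamental circuit is short.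
\<close>

lemma card_le_rank_power:
  assumes "finite M" "eulerian M" "0 \<notin> M" and short: "\<And>C. circuit M C \<Longrightarrow> card C \<le> q"
  shows "card M \<le> matroid_rank M ^ q"
proof (cases "M = {}")
  case False
  \<comment> \<open>The Eulerian matroid \<open>M\<close> has some circuit, which excludes \<open>q = 0\<close>.\<close>
  obtain D where "circuit_decomposition M D"
    using circuit_decomposition_exists assms by blast
  with False obtain C where "circuit M C"
    unfolding circuit_decomposition_def by blast
  moreover from this have "card C > 0"
    using assms(1) finite_subset by (auto simp: circuit_def card_gt_0_iff)
  ultimately have "q \<ge> 1"
    using short by fastforce
  obtain B where B: "B \<subseteq> M" "finite B" "bitvec.independent B" "M \<subseteq> bitvec.span B"
    "card B \<le> matroid_rank M"
    using basis_of_matroid[OF assms(1)] .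
  let ?F = "{S. S \<subseteq> B \<and> S \<noteq> {} \<and> card S \<le> q}"
  have "M \<subseteq> Sum ` ?F"
  proof
    fix x assume "x \<in> M"
    show "x \<in> Sum ` ?F"
    proof (cases "x \<in> B")
      case True
      with \<open>q \<ge> 1\<close> show ?thesis
        by (intro image_eqI[of _ _ "{x}"]) auto
    next
      case False
      obtain S where S: "S \<subseteq> B" "\<Sum>S = x"
        using in_span_imp_subset_sum[OF B(2)] B(4) \<open>x \<in> M\<close> by blast
      have "circuit (insert x B) (insert x S)"
        using fundamental_circuit[OF B(2,3) S(1)] S(2) False by simp
      then have circ: "circuit M (insert x S)"
        by (rule circuit_mono) (use \<open>x \<in> M\<close> B(1) in blast)
      have "finite S" "x \<notin> S"
        using S(1) B(2) False finite_subset by auto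
      then have "card S \<le> q"
        using short[OF circ] by simp
      moreover have "S \<noteq> {}"
        using S(2) \<open>x \<in> M\<close> assms(3) by auto
      ultimately show ?thesis
        using S by blast
    qed
  qed
  then have "card M \<le> card ?F"
    using B(2) by (intro surj_card_le) auto
  also have "\<dots> \<le> card B ^ q"
    by (rule card_small_nonempty_subsets_le[OF B(2)])
  also have "\<dots> \<le> matroid_rank M ^ q"
    using B(5) by (rule power_mono) simp
  finally show ?thesis .
qed simp

section \<open>Removing long circuits\<close>

lemma circuit_decomposition_insert:
  assumes "circuit M N" "circuit_decomposition (M - N) D"
  shows "circuit_decomposition M (insert N D)"
  unfolding circuit_decomposition_def
proof (intro conjI ballI)
  have sub: "K \<subseteq> M - N" "circuit M K" if "K \<in> D" for K
    using assms(2) that unfolding circuit_decomposition_def circuit_def by blast+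
  show "circuit M K" if "K \<in> insert N D" for K
    using that sub(2) assms(1) by blast
  show "pairwise disjnt (insert N D)"
    using assms(2) sub(1) unfolding circuit_decomposition_def pairwise_insert disjnt_def by blast
  have "N \<subseteq> M" "\<Union>D = M - N"
    using assms by (simp_all add: circuit_decomposition_def circuit_def)
  then show "\<Union>(insert N D) = M"
    by auto
qed

lemma card_circuit_decomposition_le:
  assumes "finite M" "circuit_decomposition M D"
  shows "card D \<le> card M"
proof -
  have D: "D \<subseteq> Pow M" "\<Union>D = M" "pairwise disjnt D" "{} \<notin> D"
    using assms(2) by (auto simp: circuit_decomposition_def circuit_def)
  have "finite D" "\<forall>N\<in>D. finite N"
    using D(1) assms(1) by (auto intro: finite_subset)
  have "card D = (\<Sum>N\<in>D. 1)"
    by simp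
  also have "\<dots> \<le> (\<Sum>N\<in>D. card N)"
    using D(4) \<open>\<forall>N\<in>D. finite N\<close> by (intro sum_mono) (metis Suc_leI card_gt_0_iff One_nat_def)
  also have "\<dots> = card M"
    using D(2,3) \<open>\<forall>N\<in>D. finite N\<close> by (metis card_Union_disjoint)
  finally show ?thesis .
qed

text \<open>
  The inequality is multiplied out by \<open>q + 1\<close> so that the induction stays in the natural numbers:
  removing a circuit lowers \<open>card M\<close> by at least \<open>q + 1\<close> and raises \<open>card D\<close> by one.
\<close>

lemma circuit_decomposition_removing_long_circuits:
  assumes "finite M" "eulerian M" "0 \<notin> M" "matroid_rank M \<le> r"
  shows "\<exists>D. circuit_decomposition M D \<and> card D * (q + 1) \<le> card M + r ^ q * (q + 1)"
  using assms
proof (induction "card M" arbitrary: M rule: less_induct)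
  case less
  show ?case
  proof (cases "\<exists>N. circuit M N \<and> card N > q")
    case True
    then obtain N where N: "circuit M N" "card N > q"
      by blast
    have NM: "N \<subseteq> M" "N \<noteq> {}" "eulerian N" "finite N"
      using N(1) less.prems(1) finite_subset by (auto simp: circuit_def)
    have card: "card (M - N) + card N = card M"
      using NM less.prems(1) by (metis add.commute card_Diff_subset card_mono le_add_diff_inverse)
    have "\<exists>D. circuit_decomposition (M - N) D \<and>
        card D * (q + 1) \<le> card (M - N) + r ^ q * (q + 1)"
    proof (rule less.hyps)
      show "card (M - N) < card M"
        using card N(2) by simp
      show "eulerian (M - N)"
        using NM less.prems by (simp add: eulerian_def sum_diff)
      show "matroid_rank (M - N) \<le> r"
        using matroid_rank_mono[of M "M - N"] less.prems by auto
    qed (use less.prems in auto)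
    then obtain D where D: "circuit_decomposition (M - N) D"
        "card D * (q + 1) \<le> card (M - N) + r ^ q * (q + 1)"
      by blast
    have "card (insert N D) * (q + 1) \<le> (card D + 1) * (q + 1)"
      by (intro mult_right_mono) (simp_all add: card_insert_le_m1 card_insert_if)
    also have "\<dots> \<le> card M + r ^ q * (q + 1)"
      using D(2) N(2) card by simp
    finally show ?thesis
      using circuit_decomposition_insert[OF N(1) D(1)] by blast
  next
    case False
    obtain D where D: "circuit_decomposition M D"
      using circuit_decomposition_exists less.prems by blast
    have "card D \<le> card M"
      using card_circuit_decomposition_le less.prems(1) D .
    also have "\<dots> \<le> matroid_rank M ^ q"
      using card_le_rank_power less.prems False by (meson linorder_not_less)
    also have "\<dots> \<le> r ^ q"
      using less.prems(4) by (rule power_mono) simp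
    finally have "card D * (q + 1) \<le> r ^ q * (q + 1)"
      by (rule mult_right_mono) simp
    with D show ?thesis
      by (meson trans_le_add2)
  qed
qed

lemma circuit_number_le:
  assumes "finite M" "eulerian M" "0 \<notin> M"
  shows "real (circuit_number M) \<le> card M / (real q + 1) + real (matroid_rank M) ^ q"
proof -
  obtain D where D: "circuit_decomposition M D"
      "card D * (q + 1) \<le> card M + matroid_rank M ^ q * (q + 1)"
    using circuit_decomposition_removing_long_circuits[OF assms order_refl] by blast
  have "circuit_number M \<le> card D"
    unfolding circuit_number_def using D(1) by (intro Least_le) blast
  moreover have "real (card D) * (real q + 1) \<le> card M + real (matroid_rank M) ^ q * (real q + 1)"
    using of_nat_mono[OF D(2), where 'a = real] by (simp add: algebra_simps)
  then have "real (card D) \<le> card M / (real q + 1) + real (matroid_rank M) ^ q"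
    by (simp add: field_simps)
  ultimately show ?thesis
    by linarith
qed

section \<open>Choosing the length\<close>

theorem theorem1p3:
  fixes \<epsilon> :: real
  assumes "\<epsilon> > 0"
  shows "\<exists>m\<^sub>0 :: nat. \<forall>n \<ge> 1. \<forall>M. binary_matroid n M \<longrightarrow> eulerian M \<longrightarrow> card M \<ge> m\<^sub>0 \<longrightarrow>
    real (circuit_number M)
      \<le> (1 + \<epsilon>) * (real (card M) * ln (real (matroid_rank M)) / ln (real (card M)))"
proof -
  \<comment> \<open>For \<open>\<delta> \<le> 1/2\<close> the factor \<open>1 / (1 - \<delta>)\<close> is at most \<open>1 + 2 * \<delta>\<close>, and a third \<open>\<delta>\<close> is needed for
    the elements that remain.\<close>
  define \<delta> where "\<delta> = min (1/2) (\<epsilon> / 3)"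
  have \<delta>: "0 < \<delta>" "\<delta> \<le> 1/2" "3 * \<delta> \<le> \<epsilon>"
    using assms by (auto simp: \<delta>_def)
  have "eventually (\<lambda>m::nat. ln (real m) / ln 2 \<le> \<delta> * real m powr \<delta>) at_top"
    using \<delta>(1) by real_asymp
  then obtain m1 where m1: "\<And>m. m \<ge> m1 \<Longrightarrow> ln (real m) / ln 2 \<le> \<delta> * real m powr \<delta>"
    by (auto simp: eventually_at_top_linorder)
  show ?thesis
  proof (intro exI[of _ "max m1 3"] allI impI)
    fix n :: nat and M
    assume M: "binary_matroid n M" "eulerian M" "max m1 3 \<le> card M"
    define m where "m = card M"
    define r where "r = matroid_rank M"
    define L where "L = ln (real m) / ln (real r)"
    define q where "q = nat \<lfloor>(1 - \<delta>) * L\<rfloor>"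
    have fin: "finite M" and zero: "0 \<notin> M"
      using M(1) binary_matroid_finite by (auto simp: binary_matroid_def)
    have m: "m \<ge> m1" "m \<ge> 3"
      using M(3) by (auto simp: m_def)
    have "r \<ge> 2"
    proof (rule ccontr)
      assume "\<not> r \<ge> 2"
      then have "(2::nat) ^ r \<le> 2 ^ 1"
        by (intro power_increasing) auto
      with m(2) card_le_two_power_rank[OF fin] show False
        by (simp add: m_def r_def)
    qed
    then have ln_r: "ln (real r) \<ge> ln 2" "ln (real r) > 0"
      by auto
    have ln_m: "ln (real m) > 0"
      using m(2) by simp
    have L_pos: "L > 0"
      using ln_r ln_m by (simp add: L_def)
    have "L \<le> ln (real m) / ln 2"
      unfolding L_def using ln_r ln_m by (intro divide_left_mono mult_pos_pos) auto
    with m1[OF m(1)] have L_le: "L \<le> \<delta> * real m powr \<delta>"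
      by linarith
    have q: "(1 - \<delta>) * L \<le> real q + 1" "real q \<le> (1 - \<delta>) * L"
      using L_pos \<delta>(2) by (auto simp: q_def of_nat_floor)
    have "real r ^ q = real r powr real q"
      using \<open>r \<ge> 2\<close> by (simp add: powr_realpow)
    also have "\<dots> \<le> real r powr ((1 - \<delta>) * L)"
      using \<open>r \<ge> 2\<close> q(2) by (intro powr_mono) auto
    also have "\<dots> = real m powr (1 - \<delta>)"
      using \<open>r \<ge> 2\<close> m(2) ln_r by (simp add: powr_def L_def)
    also have "\<dots> \<le> \<delta> * (m / L)"
    proof -
      have "real m powr (1 - \<delta>) * L \<le> real m powr (1 - \<delta>) * (\<delta> * real m powr \<delta>)"
        using L_le by (intro mult_left_mono) auto
      also have "\<dots> = \<delta> * (real m powr (1 - \<delta>) * real m powr \<delta>)"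
        by simp
      also have "\<dots> = \<delta> * m"
        using m(2) by (simp flip: powr_add)
      finally show ?thesis
        using L_pos by (simp add: field_simps)
    qed
    finally have remaining: "real r ^ q \<le> \<delta> * (m / L)" .
    have "m / (real q + 1) \<le> m / ((1 - \<delta>) * L)"
      using q(1) L_pos \<delta>(2) by (intro divide_left_mono mult_pos_pos) auto
    also have "\<dots> = (1 / (1 - \<delta>)) * (m / L)"
      by simp
    also have "\<dots> \<le> (1 + 2 * \<delta>) * (m / L)"
    proof (rule mult_right_mono)
      have "1 \<le> (1 + 2 * \<delta>) * (1 - \<delta>)"
        using mult_left_mono[OF \<delta>(2), of \<delta>] \<delta>(1) by (simp add: algebra_simps)
      then show "1 / (1 - \<delta>) \<le> 1 + 2 * \<delta>"
        using \<delta>(2) by (simp add: divide_le_eq)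
    qed (use L_pos in simp)
    finally have "m / (real q + 1) + real r ^ q \<le> (1 + 2 * \<delta>) * (m / L) + \<delta> * (m / L)"
      using remaining by (rule add_mono)
    also have "\<dots> = (1 + 3 * \<delta>) * (m / L)"
      unfolding distrib_right[symmetric] by simp
    also have "\<dots> \<le> (1 + \<epsilon>) * (m / L)"
      using \<delta>(3) L_pos by (intro mult_right_mono) auto
    finally have "real (circuit_number M) \<le> (1 + \<epsilon>) * (m / L)"
      using circuit_number_le[OF fin M(2) zero, of q] by (simp add: m_def r_def)
    then show "real (circuit_number M)
        \<le> (1 + \<epsilon>) * (real (card M) * ln (real (matroid_rank M)) / ln (real (card M)))"
      by (simp add: L_def m_def r_def)
  qed
qed

end
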